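(* For every integer $k$ there exist three polynomials $P_k,\widetilde P_k,\mathscr P_k\in\mathbb Q[n]$ and integers $N_1(k),N_2(k),N_3(k)$ such that $$A(N+k,N)=P_k(N)\quad\text{for } N\ge N_1(k),$$ $$\widetilde A(N+k,N)=\widetilde P_k(N)\quad\text{for } N\ge N_2(k),$$ $$\ell(N+k,N)=\mathscr P_k(N)\quad\text{for } N\ge N_3(k).$$
   Context: For $m\ge2$, $p_1(m)$ is the smallest prime divisor of $m$. For $2\le N\le n$, consider compositions $\boldsymbol\lambda=(\lambda_1,\dots,\lambda_N)\in\mathbb Z_{>0}^N$ with $\lambda_1+\dots+\lambda_N=n$. Define: - $A(n,N)$ (Cyrillic "el" in the paper): the number of such $\boldsymbol\lambda$ with $\min\{\lambda_1,\lambda_2\}<p_1(\lambda_1+\lambda_2)$ (the same number is obtained using $(\lambda_i,\lambda_{i+1})$ for any fixed $i\le N-1$), i.e. the number of partial flag varieties $F_{\boldsymbol\lambda}$ whose first semiclassical spectrum is not exceeding; - $\widetilde A(n,N)$: the number of such $\boldsymbol\lambda$ with $\min\{\lambda_i,\lambda_{i+1}\}<p_1(\lambda_i+\lambda_{i+1})$ for every $i=1,\dots,N-1$ (equivalently, in addition, $\lambda_i+\lambda_{i+1}-p_1(\lambda_i+\lambda_{i+1})<\max\{\lambda_i,\lambda_{i+1}\}$), i.e. the number of $F_{\boldsymbol\lambda}$ having only non-exceeding semiclassical spectra; - $\ell(n,N)$: the number of such $\boldsymbol\lambda$ with $\lambda_i+\lambda_{i+1}$ prime for every $i=1,\dots,N-1$.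 For $N=1$ and $n\ge1$ set $A(n,1)=\widetilde A(n,1)=\ell(n,1)=1$. All three vanish when $n<N$. *)

theory Defs
  imports "HOL-Computational_Algebra.Primes" "HOL-Computational_Algebra.Polynomial"
begin

definition p1 :: "nat \<Rightarrow> nat" where
  "p1 m = (LEAST p. prime p \<and> p dvd m)"

text \<open>The total n is an integer, so that pairs (N + k, N) with k negative make sense.
  Lists are indexed from 0: the i-th part of a composition xs is \<open>xs ! (i - 1)\<close>.\<close>

definition compositions :: "int \<Rightarrow> nat \<Rightarrow> nat list set" where
  "compositions n N = {xs. length xs = N \<and> (\<forall>x\<in>set xs. x > 0) \<and> int (sum_list xs) = n}"

text \<open>The count denoted by the Cyrillic letter el. For N = 1 there is no second part, and the
  value is set by convention.\<close>

definition el :: "int \<Rightarrow> nat \<Rightarrow> nat" where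
  "el n N = (if N = 1 then (if n \<ge> 1 then 1 else 0)
     else card {xs \<in> compositions n N. min (xs ! 0) (xs ! 1) < p1 (xs ! 0 + xs ! 1)})"

text \<open>In the next two counts the condition on adjacent parts is empty for N = 1, which already
  gives the conventional value 1 for n at least 1 (see below).\<close>

definition el_tilde :: "int \<Rightarrow> nat \<Rightarrow> nat" where
  "el_tilde n N = card {xs \<in> compositions n N.
     \<forall>i. i + 1 < N \<longrightarrow> min (xs ! i) (xs ! (i + 1)) < p1 (xs ! i + xs ! (i + 1))}"

definition ell :: "int \<Rightarrow> nat \<Rightarrow> nat" where
  "ell n N = card {xs \<in> compositions n N. \<forall>i. i + 1 < N \<longrightarrow> prime (xs ! i + xs ! (i + 1))}"

lemma finite_compositions: "finite (compositions n N)"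
proof (rule finite_subset)
  show "compositions n N \<subseteq> {xs. set xs \<subseteq> {..nat n} \<and> length xs = N}"
    by (auto simp: compositions_def member_le_sum_list)
  show "finite {xs. set xs \<subseteq> {..nat n} \<and> length xs = N}"
    by (rule finite_lists_length_eq) simp
qed

lemma compositions_empty: "n < int N \<Longrightarrow> compositions n N = {}"
proof -
  have "(\<forall>x\<in>set xs. x > 0) \<Longrightarrow> length xs \<le> sum_list xs" for xs :: "nat list"
    by (induction xs) auto
  then show "n < int N \<Longrightarrow> compositions n N = {}"
    by (fastforce simp: compositions_def)
qed

lemma vanish:
  assumes "n < int N"
  shows "el n N = 0" "el_tilde n N = 0" "ell n N = 0"
  using assms by (auto simp: el_def el_tilde_def ell_def compositions_empty)

lemma one_part:
  assumes "n \<ge> 1"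
  shows "el n 1 = 1" "el_tilde n 1 = 1" "ell n 1 = 1"
proof -
  have "compositions n 1 = {[nat n]}"
    using assms by (auto simp: compositions_def length_Suc_conv)
  then show "el n 1 = 1" "el_tilde n 1 = 1" "ell n 1 = 1"
    using assms by (simp_all add: el_def el_tilde_def ell_def)
qed

end

theory Submission imports Defs begin

text \<open>Subtract 1 from every part of a composition of \<open>N + k\<close> into \<open>N\<close> positive parts: what
  remains is a list of \<open>N\<close> natural numbers with sum \<open>k\<close>, a number independent of \<open>N\<close>. For
  negative \<open>k\<close> there are none. For \<open>k \<ge> 0\<close> all three numbers count such lists under conditions
  of the form \<open>R a b\<close> on adjacent entries \<open>a\<close>, \<open>b\<close>.

  So let \<open>R\<close> be any relation on the natural numbers, and let \<open>c\<^sub>j(s, N)\<close> be the number of lists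
  of length \<open>N + 1\<close> with sum \<open>s\<close>, first entry \<open>j\<close> and all adjacent pairs in \<open>R\<close>. Removing the
  first entry gives \<open>c\<^sub>j(s, N + 1) = \<Sum> c\<^sub>i(s - j, N)\<close>, summed over \<open>i \<le> s\<close> with \<open>R j i\<close>. By
  induction on \<open>s\<close>, every \<open>c\<^sub>j(s, \<cdot>)\<close> is eventually polynomial. For \<open>j > 0\<close> the right-hand side
  only involves the smaller sum \<open>s - j\<close>. For \<open>j = 0\<close> the sum does not decrease, but the only
  term not yet covered is \<open>c\<^sub>0(s, N)\<close> itself, which occurs if and only if \<open>R 0 0\<close>; in that case
  the forward difference of \<open>c\<^sub>0(s, \<cdot>)\<close> is eventually polynomial, and hence so is \<open>c\<^sub>0(s, \<cdot>)\<close>,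
  because every polynomial has a polynomial antidifference (\<open>poly_antidifference\<close>). This is
  \<open>eventually_poly_card_walks\<close>.

  The counts \<open>el_tilde\<close> and \<open>ell\<close> are sums of \<open>c\<^sub>j(k, N - 1)\<close> over \<open>j \<le> k\<close>. In \<open>el\<close> only the
  first pair is restricted, so it is a sum over the admissible first pairs of numbers \<open>c\<^sub>j\<close> for
  the relation that always holds.\<close>

section \<open>Eventually polynomial sequences\<close>

definition eventually_poly :: "(nat \<Rightarrow> rat) \<Rightarrow> bool" where
  "eventually_poly f \<longleftrightarrow> (\<exists>p. \<forall>\<^sub>F n in sequentially. f n = poly p (of_nat n))"

lemma eventually_polyI:
  assumes "\<And>n. n \<ge> m \<Longrightarrow> f n = poly p (of_nat n)"
  shows "eventually_poly f"
  unfolding eventually_poly_def eventually_sequentially using assms by blast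

lemma eventually_poly_zero: "eventually_poly (\<lambda>_. 0)"
  by (rule eventually_polyI[where p = 0]) simp

lemma eventually_poly_add:
  assumes "eventually_poly f" "eventually_poly g"
  shows "eventually_poly (\<lambda>n. f n + g n)"
proof -
  from assms obtain p q where
    "\<forall>\<^sub>F n in sequentially. f n = poly p (of_nat n)"
    "\<forall>\<^sub>F n in sequentially. g n = poly q (of_nat n)"
    by (auto simp: eventually_poly_def)
  then have "\<forall>\<^sub>F n in sequentially. f n + g n = poly (p + q) (of_nat n)"
    by eventually_elim simp
  then show ?thesis unfolding eventually_poly_def by blast
qed

lemma eventually_poly_sum:
  assumes "\<And>i. i \<in> I \<Longrightarrow> eventually_poly (f i)"
  shows "eventually_poly (\<lambda>n. \<Sum>i\<in>I. f i n)"
  using assms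
  by (induction I rule: infinite_finite_induct)
     (auto intro: eventually_poly_add eventually_poly_zero)

lemma eventually_poly_unshift:
  assumes "eventually_poly (\<lambda>n. f (Suc n))"
  shows "eventually_poly f"
proof -
  obtain p m where pm: "\<And>n. n \<ge> m \<Longrightarrow> f (Suc n) = poly p (of_nat n)"
    using assms by (auto simp: eventually_poly_def eventually_sequentially)
  show ?thesis
  proof (rule eventually_polyI[where m = "Suc m"])
    fix n assume "n \<ge> Suc m"
    then show "f n = poly (pcompose p [:-1, 1:]) (of_nat n)"
      using pm[of "n - 1"] by (cases n) (auto simp: poly_pcompose)
  qed
qed

text \<open>The forward difference of \<open>x ^ (n + 1)\<close> is \<open>(n + 1) x ^ n\<close> plus a combination of lower
  powers, which by induction already have antidifferences.\<close>

lemma power_antidifference: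
  "\<exists>q :: rat poly. \<forall>x. poly q (x + 1) - poly q x = x ^ n"
proof (induction n rule: less_induct)
  case (less n)
  then obtain q :: "nat \<Rightarrow> rat poly"
    where q: "\<And>k x. k < n \<Longrightarrow> poly (q k) (x + 1) - poly (q k) x = x ^ k"
    by metis
  let ?s = "\<Sum>k<n. smult (of_nat (Suc n choose k)) (q k)"
  let ?Q = "smult (1 / of_nat (Suc n)) (monom 1 (Suc n) - ?s)"
  have "poly ?Q (x + 1) - poly ?Q x = x ^ n" for x
  proof -
    have "(x + 1) ^ Suc n = (\<Sum>k\<le>Suc n. of_nat (Suc n choose k) * x ^ k)"
      using binomial_ring[of x 1 "Suc n"] by simp
    also have "\<dots> = (\<Sum>k<n. of_nat (Suc n choose k) * x ^ k) + of_nat (Suc n) * x ^ n + x ^ Suc n"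
      by (simp add: lessThan_Suc_atMost[symmetric] del: binomial_Suc_Suc)
    finally have binom: "(x + 1) ^ Suc n - x ^ Suc n
        = (\<Sum>k<n. of_nat (Suc n choose k) * x ^ k) + of_nat (Suc n) * x ^ n"
      by simp
    have "poly ?s (x + 1) - poly ?s x
        = (\<Sum>k<n. of_nat (Suc n choose k) * (poly (q k) (x + 1) - poly (q k) x))"
      by (simp add: poly_sum sum_subtractf right_diff_distrib del: binomial_Suc_Suc)
    also have "\<dots> = (\<Sum>k<n. of_nat (Suc n choose k) * x ^ k)"
      by (intro sum.cong) (simp_all add: q)
    finally have s: "poly ?s (x + 1) - poly ?s x
        = (\<Sum>k<n. of_nat (Suc n choose k) * x ^ k)" .
    have "poly ?Q (x + 1) - poly ?Q x
        = 1 / of_nat (Suc n) * (((x + 1) ^ Suc n - x ^ Suc n) - (poly ?s (x + 1) - poly ?s x))"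
      unfolding poly_smult poly_diff poly_monom by (simp only: algebra_simps mult_1_left)
    also have "\<dots> = x ^ n"
      unfolding binom s by (simp del: of_nat_Suc)
    finally show ?thesis .
  qed
  then show ?case by blast
qed

lemma poly_antidifference:
  fixes p :: "rat poly"
  shows "\<exists>q. \<forall>x. poly q (x + 1) - poly q x = poly p x"
proof -
  obtain q :: "nat \<Rightarrow> rat poly"
    where q: "\<And>k x. poly (q k) (x + 1) - poly (q k) x = x ^ k"
    using power_antidifference by metis
  have "poly (\<Sum>k\<le>degree p. smult (coeff p k) (q k)) (x + 1)
      - poly (\<Sum>k\<le>degree p. smult (coeff p k) (q k)) x = poly p x" for x
  proof -
    have "poly p x = (\<Sum>k\<le>degree p. coeff p k * (poly (q k) (x + 1) - poly (q k) x))"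
      unfolding q by (rule poly_altdef)
    then show ?thesis
      by (simp add: poly_sum sum_subtractf right_diff_distrib)
  qed
  then show ?thesis by blast
qed

text \<open>From some index on, the sequence differs from a polynomial antidifference of its forward
  difference by a constant.\<close>

lemma eventually_poly_of_difference:
  assumes "eventually_poly g" "\<And>n. f (Suc n) = f n + g n"
  shows "eventually_poly f"
proof -
  obtain p m where pm: "\<And>n. n \<ge> m \<Longrightarrow> g n = poly p (of_nat n)"
    using assms(1) by (auto simp: eventually_poly_def eventually_sequentially)
  obtain q where q: "\<And>x. poly q (x + 1) - poly q x = poly p x"
    using poly_antidifference by blast
  define c where "c = f m - poly q (of_nat m)"
  show ?thesis
  proof (rule eventually_polyI[where m = m])
    fix n assume "n \<ge> m"
    then show "f n = poly (q + [:c:]) (of_nat n)"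
    proof (induction n rule: dec_induct)
      case base
      show ?case by (simp add: c_def)
    next
      case (step n)
      then show ?case
        using assms(2)[of n] pm[of n] q[of "of_nat n"] by (simp add: algebra_simps)
    qed
  qed
qed

section \<open>Lists with fixed sum and constrained neighbours\<close>

text \<open>A walk is given by its entries after the starting point \<open>j\<close>. Its sum \<open>s\<close> includes \<open>j\<close>,
  while \<open>N\<close> counts only the later entries: the cardinality is the number \<open>c\<^sub>j(s, N)\<close> above.\<close>

definition walks :: "(nat \<Rightarrow> nat \<Rightarrow> bool) \<Rightarrow> nat \<Rightarrow> nat \<Rightarrow> nat \<Rightarrow> nat list set" where
  "walks R j s N = {ys. length ys = N \<and> j + sum_list ys = s \<and> successively R (j # ys)}"

lemma finite_walks: "finite (walks R j s N)"
proof (rule finite_subset)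
  show "walks R j s N \<subseteq> {ys. set ys \<subseteq> {..s} \<and> length ys = N}"
    by (auto simp: walks_def intro: trans_le_add2 member_le_sum_list)
  show "finite {ys. set ys \<subseteq> {..s} \<and> length ys = N}"
    by (rule finite_lists_length_eq) simp
qed

text \<open>The restriction \<open>i \<le> s\<close> only makes the index set finite: a walk starting above its
  sum does not exist.\<close>

lemma card_walks_Suc:
  "card (walks R j s (Suc N))
    = (if j \<le> s then \<Sum>i | i \<le> s \<and> R j i. card (walks R i (s - j) N) else 0)"
proof (cases "j \<le> s")
  case True
  have decomp: "walks R j s (Suc N)
      = (\<Union>i\<in>{i. i \<le> s \<and> R j i}. (#) i ` walks R i (s - j) N)"
  proof (rule set_eqI)
    fix ys
    show "ys \<in> walks R j s (Suc N)
        \<longleftrightarrow> ys \<in> (\<Union>i\<in>{i. i \<le> s \<and> R j i}. (#) i ` walks R i (s - j) N)"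
      using True by (cases ys) (auto simp: walks_def image_iff)
  qed
  have "card (walks R j s (Suc N)) = (\<Sum>i | i \<le> s \<and> R j i. card ((#) i ` walks R i (s - j) N))"
    unfolding decomp by (intro card_UN_disjoint) (auto simp: finite_walks)
  also have "\<dots> = (\<Sum>i | i \<le> s \<and> R j i. card (walks R i (s - j) N))"
    by (intro sum.cong refl card_image) simp
  finally show ?thesis using True by simp
qed (auto simp: walks_def)

lemma eventually_poly_card_walks:
  "eventually_poly (\<lambda>N. of_nat (card (walks R j s N)))"
proof (induction s arbitrary: j rule: less_induct)
  case (less s)
  have pos: "eventually_poly (\<lambda>N. of_nat (card (walks R j s N)))" if "j > 0" for j
  proof (rule eventually_poly_unshift)
    show "eventually_poly (\<lambda>N. of_nat (card (walks R j s (Suc N))))"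
    proof (cases "j \<le> s")
      case True
      then show ?thesis
        using that by (simp add: card_walks_Suc eventually_poly_sum less.IH)
    qed (simp add: card_walks_Suc eventually_poly_zero)
  qed
  have zero: "eventually_poly (\<lambda>N. of_nat (card (walks R 0 s N)))"
  proof -
    let ?I = "{i. i \<le> s \<and> R 0 i}"
    let ?g = "\<lambda>N. \<Sum>i\<in>?I - {0}. of_nat (card (walks R i s N)) :: rat"
    have g: "eventually_poly ?g"
      by (intro eventually_poly_sum pos) simp
    show ?thesis
    proof (cases "R 0 0")
      case True
      then have "of_nat (card (walks R 0 s (Suc N))) = of_nat (card (walks R 0 s N)) + ?g N" for N
        by (simp add: card_walks_Suc sum.remove[of ?I 0])
      then show ?thesis by (rule eventually_poly_of_difference[OF g])
    next
      case False
      then have "?I - {0} = ?I" by auto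
      then have "of_nat (card (walks R 0 s (Suc N))) = ?g N" for N
        by (simp add: card_walks_Suc)
      then have "eventually_poly (\<lambda>N. of_nat (card (walks R 0 s (Suc N))))"
        using g by simp
      then show ?thesis by (rule eventually_poly_unshift)
    qed
  qed
  show ?case using pos zero by (cases "j = 0") auto
qed

section \<open>Compositions with constrained neighbours\<close>

lemma card_compositions_filter:
  "card {xs \<in> compositions (int N + int k) N. Q xs}
    = card {ys. length ys = N \<and> sum_list ys = k \<and> Q (map Suc ys)}"
proof -
  have sum: "sum_list (map Suc ys) = length ys + sum_list ys" for ys
    by (induction ys) auto
  have "{xs \<in> compositions (int N + int k) N. Q xs}
      = map Suc ` {ys. length ys = N \<and> sum_list ys = k \<and> Q (map Suc ys)}" (is "?A = ?B")
  proof
    show "?A \<subseteq> ?B"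
    proof
      fix xs assume xs: "xs \<in> ?A"
      define ys where "ys = map (\<lambda>x. x - 1) xs"
      have "map Suc ys = xs"
        using xs by (auto simp: ys_def compositions_def intro!: map_idI)
      then show "xs \<in> ?B"
        using xs sum[of ys] by (auto simp: compositions_def image_iff intro!: exI[of _ ys])
    qed
    show "?B \<subseteq> ?A" by (auto simp: compositions_def sum)
  qed
  then show ?thesis by (simp only: card_image inj_on_subset[OF inj_mapI[OF inj_Suc] subset_UNIV])
qed

lemma eventually_poly_adjacent:
  "eventually_poly (\<lambda>N. of_nat (card {xs \<in> compositions (int N + int k) N.
     \<forall>i. i + 1 < N \<longrightarrow> R (xs ! i) (xs ! (i + 1))}))"
proof (rule eventually_poly_unshift)
  let ?R = "\<lambda>a b. R (Suc a) (Suc b)"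
  have "card {xs \<in> compositions (int (Suc M) + int k) (Suc M).
          \<forall>i. i + 1 < Suc M \<longrightarrow> R (xs ! i) (xs ! (i + 1))}
      = (\<Sum>j\<le>k. card (walks ?R j k M))" for M
  proof -
    have adjacent: "{ys. length ys = Suc M \<and> sum_list ys = k
          \<and> (\<forall>i. i + 1 < Suc M \<longrightarrow> R (map Suc ys ! i) (map Suc ys ! (i + 1)))}
        = {ys. length ys = Suc M \<and> sum_list ys = k \<and> successively ?R ys}"
      by (auto simp: successively_conv_nth)
    have decomp: "{ys. length ys = Suc M \<and> sum_list ys = k \<and> successively ?R ys}
        = (\<Union>j\<in>{..k}. (#) j ` walks ?R j k M)"
    proof (rule set_eqI)
      fix ys
      show "ys \<in> {ys. length ys = Suc M \<and> sum_list ys = k \<and> successively ?R ys}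
          \<longleftrightarrow> ys \<in> (\<Union>j\<in>{..k}. (#) j ` walks ?R j k M)"
        by (cases ys) (auto simp: walks_def image_iff)
    qed
    have "card {ys. length ys = Suc M \<and> sum_list ys = k \<and> successively ?R ys}
        = (\<Sum>j\<le>k. card ((#) j ` walks ?R j k M))"
      unfolding decomp by (intro card_UN_disjoint) (auto simp: finite_walks)
    also have "\<dots> = (\<Sum>j\<le>k. card (walks ?R j k M))"
      by (intro sum.cong refl card_image) simp
    finally show ?thesis by (simp only: card_compositions_filter adjacent)
  qed
  then show "eventually_poly (\<lambda>M. of_nat (card {xs \<in> compositions (int (Suc M) + int k) (Suc M).
      \<forall>i. i + 1 < Suc M \<longrightarrow> R (xs ! i) (xs ! (i + 1))}))"
    by (simp only: of_nat_sum) (intro eventually_poly_sum eventually_poly_card_walks)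
qed

lemma eventually_poly_first_pair:
  "eventually_poly (\<lambda>N. of_nat (card {xs \<in> compositions (int N + int k) N.
     R (xs ! 0) (xs ! 1)}))"
proof (rule eventually_poly_unshift, rule eventually_poly_unshift)
  let ?T = "\<lambda>_ _. True"
  let ?I = "{(i, j). i \<le> k \<and> j \<le> k \<and> R (Suc i) (Suc j)}"
  have fin: "finite ?I"
    by (rule finite_subset[of _ "{..k} \<times> {..k}"]) auto
  have "card {xs \<in> compositions (int (Suc (Suc M)) + int k) (Suc (Suc M)). R (xs ! 0) (xs ! 1)}
      = (\<Sum>(i, j)\<in>?I. card (walks ?T j (k - i) M))" for M
  proof -
    have decomp: "{ys. length ys = Suc (Suc M) \<and> sum_list ys = k \<and> R (map Suc ys ! 0) (map Suc ys ! 1)}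
        = (\<Union>(i, j)\<in>?I. (\<lambda>ys. i # j # ys) ` walks ?T j (k - i) M)"
    proof (rule set_eqI)
      fix ys
      show "ys \<in> {ys. length ys = Suc (Suc M) \<and> sum_list ys = k
            \<and> R (map Suc ys ! 0) (map Suc ys ! 1)}
          \<longleftrightarrow> ys \<in> (\<Union>(i, j)\<in>?I. (\<lambda>ys. i # j # ys) ` walks ?T j (k - i) M)"
        by (cases ys rule: remdups_adj.cases) (auto simp: walks_def image_iff successively_conv_nth)
    qed
    have "card {ys. length ys = Suc (Suc M) \<and> sum_list ys = k
          \<and> R (map Suc ys ! 0) (map Suc ys ! 1)}
        = (\<Sum>z\<in>?I. card (case z of (i, j) \<Rightarrow> (\<lambda>ys. i # j # ys) ` walks ?T j (k - i) M))"
      unfolding decomp by (intro card_UN_disjoint fin) (auto simp: finite_walks)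
    also have "\<dots> = (\<Sum>(i, j)\<in>?I. card (walks ?T j (k - i) M))"
      by (intro sum.cong) (auto intro!: card_image inj_onI)
    finally show ?thesis by (simp only: card_compositions_filter)
  qed
  then show "eventually_poly (\<lambda>M. of_nat (card {xs \<in>
      compositions (int (Suc (Suc M)) + int k) (Suc (Suc M)). R (xs ! 0) (xs ! 1)}))"
    by (simp only: of_nat_sum)
       (intro eventually_poly_sum, auto intro: eventually_poly_card_walks)
qed

section \<open>The three counts\<close>

lemma eventually_poly_el: "eventually_poly (\<lambda>N. of_nat (el (int N + int k) N))"
proof -
  have "eventually_poly (\<lambda>N. of_nat (card {xs \<in> compositions (int N + int k) N.
      min (xs ! 0) (xs ! 1) < p1 (xs ! 0 + xs ! 1)}))"
    by (rule eventually_poly_first_pair)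
  then obtain p m where pm: "\<And>N. N \<ge> m \<Longrightarrow>
      of_nat (card {xs \<in> compositions (int N + int k) N.
        min (xs ! 0) (xs ! 1) < p1 (xs ! 0 + xs ! 1)}) = poly p (of_nat N :: rat)"
    by (auto simp: eventually_poly_def eventually_sequentially)
  \<comment> \<open>The bound 2 skips the conventional value at \<open>N = 1\<close>.\<close>
  show ?thesis
    by (rule eventually_polyI[where m = "max 2 m" and p = p]) (simp add: el_def pm del: One_nat_def)
qed

lemma polynomial_from_nonnegative_excess:
  fixes F :: "int \<Rightarrow> nat \<Rightarrow> nat"
  assumes "\<And>k. eventually_poly (\<lambda>N. of_nat (F (int N + int k) N))"
    and "\<And>n N. n < int N \<Longrightarrow> F n N = 0"
  shows "\<exists>(P :: rat poly) (N0 :: int). \<forall>N::nat. N \<ge> 1 \<and> int N \<ge> N0 \<longrightarrow>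
    of_nat (F (int N + k) N) = poly P (of_nat N)"
proof (cases "k < 0")
  case True
  then have "of_nat (F (int N + k) N) = poly (0 :: rat poly) (of_nat N)" for N
    using assms(2) by simp
  then show ?thesis by blast
next
  case False
  then obtain P m where "\<And>N. N \<ge> m \<Longrightarrow> of_nat (F (int N + k) N) = poly P (of_nat N :: rat)"
    using assms(1)[of "nat k"] by (auto simp: eventually_poly_def eventually_sequentially)
  then show ?thesis by (intro exI[of _ P] exI[of _ "int m"]) simp
qed

theorem theorem1p4:
  fixes k :: int
  shows "\<exists>(P :: rat poly) (P' :: rat poly) (P'' :: rat poly) (N1 :: int) (N2 :: int) (N3 :: int).
    (\<forall>N::nat. N \<ge> 1 \<and> int N \<ge> N1 \<longrightarrow> of_nat (el (int N + k) N) = poly P (of_nat N)) \<and>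
    (\<forall>N::nat. N \<ge> 1 \<and> int N \<ge> N2 \<longrightarrow> of_nat (el_tilde (int N + k) N) = poly P' (of_nat N)) \<and>
    (\<forall>N::nat. N \<ge> 1 \<and> int N \<ge> N3 \<longrightarrow> of_nat (ell (int N + k) N) = poly P'' (of_nat N))"
proof -
  have tilde: "eventually_poly (\<lambda>N. of_nat (el_tilde (int N + int k) N))" for k
    unfolding el_tilde_def
    by (rule eventually_poly_adjacent[where R = "\<lambda>a b. min a b < p1 (a + b)"])
  have ell: "eventually_poly (\<lambda>N. of_nat (ell (int N + int k) N))" for k
    unfolding ell_def by (rule eventually_poly_adjacent[where R = "\<lambda>a b. prime (a + b)"])
  note result = polynomial_from_nonnegative_excess[where k = k]
  show ?thesis
    using result[of el, OF eventually_poly_el vanish(1)]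
      result[of el_tilde, OF tilde vanish(2)] result[of ell, OF ell vanish(3)]
    by metis
qed

end
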